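(* For every $n\ge 1$ and every $f:\{0,1\}^n\to\{0,1\}$, $\mathrm{FC}(f)\le \mathrm{EC}(f)$.
   Context: Let $f:\{0,1\}^n\to\{0,1\}$ and $[n]=\{1,\dots,n\}$. Fractional certificate complexity: for $x\in\{0,1\}^n$, $\mathrm{FC}(f,x)$ is the optimal value of the linear program: minimize $\sum_{i\in[n]}v_x(i)$ over $v_x\in\mathbb R^n$ with $v_x(i)\ge 0$ for all $i$, subject to $\sum_{i:x_i\ne y_i}v_x(i)\ge 1$ for all $y$ with $f(y)\ne f(x)$. $\mathrm{FC}(f)=\max_{x}\mathrm{FC}(f,x)$. The expectational certificate complexity $\mathrm{EC}(f)$ is the optimal value of the following program over families $\{w_x\}_{x\in\{0,1\}^n}$, $w_x\in\mathbb R^n$: minimize $\max_{x}\sum_{i=1}^n w_x(i)$ subject to $\sum_{i:x_i\ne y_i} w_x(i)w_y(i)\ge 1$ for all $x,y$ with $f(x)\ne f(y)$, and $0\le w_x(i)\le 1$ for all $x\in\{0,1\}^n$, $i\in[n]$. *)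

theory Defs
  imports "HOL-Analysis.Analysis"
begin

text \<open>
  The finite index type \<open>'n\<close> plays the role of \<open>[n]\<close>, with \<open>n = CARD('n) \<ge> 1\<close>; the cube
  \<open>{0,1}\<^sup>n\<close> is the finite type \<^typ>\<open>bool^'n\<close>. The optimal value of a minimization program is
  the infimum of the objective over the feasible set. \<^const>\<open>Inf\<close> on the reals is meaningful
  only for nonempty sets that are bounded below; the lemmas below confirm this for both programs.
\<close>

definition FC_feasible :: "(bool^'n \<Rightarrow> bool) \<Rightarrow> bool^'n \<Rightarrow> real^'n \<Rightarrow> bool" where
  "FC_feasible f x v \<longleftrightarrow>
     (\<forall>i. 0 \<le> v $ i) \<and>
     (\<forall>y. f y \<noteq> f x \<longrightarrow> (\<Sum>i \<in> {i. x $ i \<noteq> y $ i}. v $ i) \<ge> 1)"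

definition FC_at :: "(bool^'n \<Rightarrow> bool) \<Rightarrow> bool^'n \<Rightarrow> real" where
  "FC_at f x = Inf {\<Sum>i\<in>UNIV. v $ i | v. FC_feasible f x v}"

definition FC :: "(bool^'n \<Rightarrow> bool) \<Rightarrow> real" where
  "FC f = Max (range (FC_at f))"

definition EC_feasible :: "(bool^'n \<Rightarrow> bool) \<Rightarrow> (bool^'n \<Rightarrow> real^'n) \<Rightarrow> bool" where
  "EC_feasible f w \<longleftrightarrow>
     (\<forall>x y. f x \<noteq> f y \<longrightarrow> (\<Sum>i \<in> {i. x $ i \<noteq> y $ i}. w x $ i * w y $ i) \<ge> 1) \<and>
     (\<forall>x i. 0 \<le> w x $ i \<and> w x $ i \<le> 1)"

definition EC :: "(bool^'n \<Rightarrow> bool) \<Rightarrow> real" where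
  "EC f = Inf {Max (range (\<lambda>x. \<Sum>i\<in>UNIV. w x $ i)) | w. EC_feasible f w}"

lemma card_differing_ge_1:
  fixes f :: "bool^'n \<Rightarrow> bool"
  assumes "f x \<noteq> f y"
  shows "1 \<le> real (card {i. x $ i \<noteq> y $ i})"
proof -
  from assms have "x \<noteq> y" by auto
  then have "{i. x $ i \<noteq> y $ i} \<noteq> {}" by (auto simp: vec_eq_iff)
  then have "card {i. x $ i \<noteq> y $ i} > 0" by (simp add: card_gt_0_iff)
  then show ?thesis by linarith
qed

lemma FC_feasible_one: "FC_feasible f x (\<chi> i. 1)"
  using card_differing_ge_1[of f x] by (auto simp: FC_feasible_def)

lemma FC_bdd_below: "bdd_below {\<Sum>i\<in>UNIV. v $ i | v. FC_feasible f x v}"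
  by (rule bdd_belowI[of _ 0]) (auto simp: FC_feasible_def intro: sum_nonneg)

lemma EC_feasible_one: "EC_feasible f (\<lambda>x. \<chi> i. 1)"
  using card_differing_ge_1[of f] by (auto simp: EC_feasible_def)

lemma EC_bdd_below: "bdd_below {Max (range (\<lambda>x. \<Sum>i\<in>UNIV. w x $ i)) | w. EC_feasible f w}"
proof (rule bdd_belowI[of _ 0], clarify)
  fix w assume w: "EC_feasible f w"
  have "0 \<le> (\<Sum>i\<in>UNIV. w undefined $ i)"
    using w by (intro sum_nonneg) (auto simp: EC_feasible_def)
  also have "\<dots> \<le> Max (range (\<lambda>x. \<Sum>i\<in>UNIV. w x $ i))"
    by (intro Max_ge) auto
  finally show "0 \<le> Max (range (\<lambda>x. \<Sum>i\<in>UNIV. w x $ i))" .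
qed

end

theory Submission
  imports Defs
begin

text \<open>Each member \<open>w x\<close> of an EC-feasible family is by itself a fractional
  certificate for \<open>f\<close> at \<open>x\<close> (\<open>EC_feasible_imp_FC_feasible\<close>).
  So \<open>FC_at f x\<close> is at most the total weight of \<open>w x\<close>, hence at most the
  objective value of \<open>w\<close>. Maximizing over \<open>x\<close> and then taking the infimum
  over \<open>w\<close> gives the inequality.\<close>

lemma EC_feasible_imp_FC_feasible:
  assumes "EC_feasible f w"
  shows "FC_feasible f x (w x)"
  unfolding FC_feasible_def
proof (intro conjI allI impI)
  fix i
  show "0 \<le> w x $ i" using assms by (simp add: EC_feasible_def)
next
  fix y assume "f y \<noteq> f x"
  then have "1 \<le> (\<Sum>i \<in> {i. x $ i \<noteq> y $ i}. w x $ i * w y $ i)"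
    using assms unfolding EC_feasible_def by metis
  \<comment> \<open>Since \<open>w y $ i\<close> is at most 1 and \<open>w x $ i\<close> is
    nonnegative, dropping the factor \<open>w y $ i\<close> can only increase each term.\<close>
  also have "\<dots> \<le> (\<Sum>i \<in> {i. x $ i \<noteq> y $ i}. w x $ i)"
    using assms by (intro sum_mono mult_left_le) (auto simp: EC_feasible_def)
  finally show "1 \<le> (\<Sum>i \<in> {i. x $ i \<noteq> y $ i}. w x $ i)" .
qed

theorem lemma7:
  fixes f :: "bool^'n \<Rightarrow> bool"
  shows "FC f \<le> EC f"
  unfolding EC_def
proof (rule cInf_greatest)
  \<comment> \<open>The all-ones family is feasible; a lower bound on the elements bounds
    \<open>Inf\<close> only for a nonempty set.\<close>
  show "{Max (range (\<lambda>x. \<Sum>i\<in>UNIV. w x $ i)) | w. EC_feasible f w} \<noteq> {}"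
    using EC_feasible_one by blast
next
  fix m assume "m \<in> {Max (range (\<lambda>x. \<Sum>i\<in>UNIV. w x $ i)) | w. EC_feasible f w}"
  then obtain w where m: "m = Max (range (\<lambda>x. \<Sum>i\<in>UNIV. w x $ i))" and w: "EC_feasible f w"
    by blast
  have "FC_at f x \<le> m" for x
  proof -
    have "FC_at f x \<le> (\<Sum>i\<in>UNIV. w x $ i)"
      unfolding FC_at_def using EC_feasible_imp_FC_feasible[OF w]
      by (intro cInf_lower FC_bdd_below) blast
    also have "\<dots> \<le> m"
      unfolding m by (intro Max_ge) auto
    finally show ?thesis .
  qed
  then show "FC f \<le> m"
    unfolding FC_def by (subst Max_le_iff) auto
qed

end
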